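(* Let $S=\langle g_1,g_2,g_3\rangle$ be a numerical semigroup minimally generated by three elements $g_1<g_2<g_3$. The following conditions are equivalent: (i) $\mathrm{Ap}(S)$ is $\beta$-rectangular; (ii) $\mathrm{Ap}(S)$ is $\gamma$-rectangular; (iii) $S$ is $M$-pure symmetric (that is, $S$ is $M$-pure and symmetric).
   Context: A numerical semigroup is a submonoid $S$ of $(\mathbb N,+)$, $0\in\mathbb N$, with finite complement in $\mathbb N$. For a numerical semigroup minimally generated by $g_1<\dots<g_\nu$ (here $\nu=3$), the multiplicity $m=g_1$ is the least positive element of $S$, and the Frobenius number is $f=\max\{z\in\mathbb Z : z\notin S\}$. The Apéry set is $\mathrm{Ap}(S)=\{\omega\in S : \omega-m\notin S\}$. $S$ is symmetric if for every integer $x$, $f-x\notin S$ implies $x\in S$. Let $M=S\setminus\{0\}$, $hM=M+\dots+M$ ($h$ summands), $0M=S$. The order $\mathrm{ord}(s)$ of $s\in S$ is the unique $h\in\mathbb N$ with $s\in hM\setminus(h+1)M$. For $s,t\in S$, write $s\preceq_M t$ if there is $u\in S$ with $s+u=t$ and $\mathrm{ord}(s)+\mathrm{ord}(u)=\mathrm{ord}(t)$. $S$ is $M$-pure if all the maximal elements of $\mathrm{Ap}(S)$ with respect to the partial order $\preceq_M$ have the same order. A representation of $s\in S$ is an expression $s=\lambda_1g_1+\dots+\lambda_\nu g_\nu$ with $\lambda_i\in\mathbb N$; it is maximal if $\lambda_1+\dots+\lambda_\nu=\mathrm{ord}(s)$. For $i=2,\dots,\nu$ let $\beta_i=\max\{h\in\mathbb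 N : hg_i\in\mathrm{Ap}(S)\text{ and }\mathrm{ord}(hg_i)=h\}$ and $\gamma_i=\max\{h\in\mathbb N : hg_i\in\mathrm{Ap}(S),\ \mathrm{ord}(hg_i)=h \text{ and } hg_i \text{ has a unique maximal representation}\}$. Let $B=\{\sum_{i=2}^\nu\lambda_ig_i : 0\le\lambda_i\le\beta_i\}$ and $\Gamma=\{\sum_{i=2}^\nu\lambda_ig_i : 0\le\lambda_i\le\gamma_i\}$. $\mathrm{Ap}(S)$ is $\beta$-rectangular if $\mathrm{Ap}(S)=B$, and $\gamma$-rectangular if $\mathrm{Ap}(S)=\Gamma$. *)

theory Defs
  imports Main
begin

definition numerical_semigroup :: "nat set \<Rightarrow> bool" where
  "numerical_semigroup S \<longleftrightarrow>
     0 \<in> S \<and> (\<forall>x\<in>S. \<forall>y\<in>S. x + y \<in> S) \<and> finite (UNIV - S)"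

definition generated :: "nat set \<Rightarrow> nat set" where
  "generated G = {(\<Sum>g\<in>G. c g * g) | c. True}"

definition minimally_generated :: "nat set \<Rightarrow> nat set \<Rightarrow> bool" where
  "minimally_generated S G \<longleftrightarrow>
     finite G \<and> S = generated G \<and> (\<forall>H. H \<subset> G \<longrightarrow> generated H \<noteq> S)"

definition multiplicity :: "nat set \<Rightarrow> nat" where
  "multiplicity S = (LEAST x. x \<in> S \<and> 0 < x)"

(* The maximum is over the integers, hence over an infinite set (all negative integers
   lie outside S): Max would be unspecified there. *)
definition frobenius :: "nat set \<Rightarrow> int" where
  "frobenius S = (GREATEST z. z \<notin> int ` S)"

definition apery :: "nat set \<Rightarrow> nat set" where
  "apery S = {w \<in> S. int w - int (multiplicity S) \<notin> int ` S}"

definition symmetric :: "nat set \<Rightarrow> bool" where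
  "symmetric S \<longleftrightarrow> (\<forall>x::int. frobenius S - x \<notin> int ` S \<longrightarrow> x \<in> int ` S)"

(* hM for M = S - {0}, with the convention 0M = S. *)
definition multiple_M :: "nat set \<Rightarrow> nat \<Rightarrow> nat set" where
  "multiple_M S h =
     (if h = 0 then S else {sum_list xs | xs. length xs = h \<and> set xs \<subseteq> S - {0}})"

definition ord :: "nat set \<Rightarrow> nat \<Rightarrow> nat" where
  "ord S s = (THE h. s \<in> multiple_M S h - multiple_M S (h + 1))"

definition le_M :: "nat set \<Rightarrow> nat \<Rightarrow> nat \<Rightarrow> bool" where
  "le_M S s t \<longleftrightarrow>
     s \<in> S \<and> t \<in> S \<and> (\<exists>u\<in>S. s + u = t \<and> ord S s + ord S u = ord S t)"

definition maximal_apery :: "nat set \<Rightarrow> nat set" where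
  "maximal_apery S = {w \<in> apery S. \<forall>v\<in>apery S. le_M S w v \<longrightarrow> v = w}"

definition M_pure :: "nat set \<Rightarrow> bool" where
  "M_pure S \<longleftrightarrow> (\<forall>v\<in>maximal_apery S. \<forall>w\<in>maximal_apery S. ord S v = ord S w)"

(* Representations are coefficient families indexed by the generators themselves;
   they vanish outside G so that distinct functions are distinct representations. *)
definition representations :: "nat set \<Rightarrow> nat \<Rightarrow> (nat \<Rightarrow> nat) set" where
  "representations G s = {c. (\<forall>x. x \<notin> G \<longrightarrow> c x = 0) \<and> s = (\<Sum>g\<in>G. c g * g)}"

definition maximal_representations :: "nat set \<Rightarrow> nat set \<Rightarrow> nat \<Rightarrow> (nat \<Rightarrow> nat) set" where
  "maximal_representations S G s =
     {c \<in> representations G s. (\<Sum>g\<in>G. c g) = ord S s}"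

(* In the following, G is the minimal generating set of S, so its least element is the
   multiplicity; the bounds are indexed by the generator g = g_i rather than by i. *)

definition beta :: "nat set \<Rightarrow> nat \<Rightarrow> nat" where
  "beta S g = Max {h. h * g \<in> apery S \<and> ord S (h * g) = h}"

definition gamma :: "nat set \<Rightarrow> nat set \<Rightarrow> nat \<Rightarrow> nat" where
  "gamma S G g =
     Max {h. h * g \<in> apery S \<and> ord S (h * g) = h \<and>
             (\<exists>!c. c \<in> maximal_representations S G (h * g))}"

definition box :: "nat set \<Rightarrow> (nat \<Rightarrow> nat) \<Rightarrow> nat set" where
  "box G b = {(\<Sum>g\<in>G. c g * g) | c. \<forall>g\<in>G. c g \<le> b g}"

definition beta_rectangular :: "nat set \<Rightarrow> nat set \<Rightarrow> bool" where
  "beta_rectangular S G \<longleftrightarrow> apery S = box (G - {multiplicity S}) (beta S)"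

definition gamma_rectangular :: "nat set \<Rightarrow> nat set \<Rightarrow> bool" where
  "gamma_rectangular S G \<longleftrightarrow> apery S = box (G - {multiplicity S}) (gamma S G)"

end

(*
  Since m = g1 never occurs in a representation of an Apery element and g2 \<noteq> g3, such an element
  has exactly one maximal representation, namely the one with the largest coefficient at g2. Hence
  beta and gamma agree and (i) and (ii) are the same condition; moreover Ap(S) always lies in the
  box B. If Ap(S) = B, all maximal representations come from the box, so the corner of the box lies
  above every Apery element for the order of M: this gives M-purity and symmetry.

  Conversely let w be the largest Apery element, with maximal representation p g2 + q g3. An Apery
  element above beta_3 g3 that is maximal for the order of M has, by M-purity, the same order as w,
  so comparing sizes forces q = beta_3. By symmetry w - beta_2 g2 is in Ap(S), which forces
  p = beta_2; so w is the corner of B and B is contained in Ap(S).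
*)
theory Submission
  imports Defs
begin

text \<open>\<open>m\<close>, \<open>a\<close>, \<open>b\<close> are the generators in increasing
  order. Membership is stated through coefficient triples, so that orders and Apery elements reduce
  to arithmetic on coefficients.\<close>

locale three_generated =
  fixes S :: "nat set" and m a b :: nat
  assumes m_pos: "0 < m" and m_less_a: "m < a" and a_less_b: "a < b"
    and mem_S_iff: "s \<in> S \<longleftrightarrow> (\<exists>x y z. s = x * m + y * a + z * b)"
    and finite_gaps: "finite (UNIV - S)"
begin

lemma mem_S: "x * m + y * a + z * b \<in> S"
  using mem_S_iff by blast

lemma zero_mem: "0 \<in> S"
  using mem_S[of 0 0 0] by simp

lemma ab_mem: "y * a + z * b \<in> S"
  using mem_S[of 0 y z] by simp

lemma add_mem:
  assumes "s \<in> S" "t \<in> S"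
  shows "s + t \<in> S"
proof -
  obtain x y z x' y' z' where "s = x * m + y * a + z * b" "t = x' * m + y' * a + z' * b"
    using assms mem_S_iff by meson
  then have "s + t = (x + x') * m + (y + y') * a + (z + z') * b"
    by (simp add: algebra_simps)
  then show ?thesis
    using mem_S by metis
qed

lemma add_multiple_mem: "s \<in> S \<Longrightarrow> s + k * m \<in> S"
  using add_mem mem_S[of k 0 0] by simp

lemma multiplicity_eq: "multiplicity S = m"
  unfolding multiplicity_def
proof (rule Least_equality)
  show "m \<in> S \<and> 0 < m"
    using mem_S[of 1 0 0] m_pos by simp
next
  fix s assume s: "s \<in> S \<and> 0 < s"
  then obtain x y z where xyz: "s = x * m + y * a + z * b"
    using mem_S_iff by blast
  consider "x > 0" | "y > 0" | "z > 0"
    using s xyz by fastforce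
  then show "m \<le> s"
  proof cases
    case 1
    then have "1 * m \<le> x * m" by (intro mult_right_mono) auto
    then show ?thesis using xyz by linarith
  next
    case 2
    then have "1 * a \<le> y * a" by (intro mult_right_mono) auto
    then show ?thesis using xyz m_less_a by linarith
  next
    case 3
    then have "1 * b \<le> z * b" by (intro mult_right_mono) auto
    then show ?thesis using xyz m_less_a a_less_b by linarith
  qed
qed

section \<open>Order as the length of a longest representation\<close>

lemma length_le: "x + y + z \<le> x * m + y * a + z * b"
proof -
  have "x \<le> x * m" "y \<le> y * a" "z \<le> z * b"
    using m_pos m_less_a a_less_b by simp_all
  then show ?thesis by linarith
qed

text \<open>Each nonzero summand uses at least one generator, so expanding all summands into
  generators cannot shorten the sum.\<close>

lemma sum_list_representation:
  "set xs \<subseteq> S - {0} \<Longrightarrow>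
     \<exists>x y z. sum_list xs = x * m + y * a + z * b \<and> length xs \<le> x + y + z"
proof (induction xs)
  case Nil
  show ?case by (rule exI[of _ 0])+ simp
next
  case (Cons s xs)
  then obtain x y z where 1: "sum_list xs = x * m + y * a + z * b" "length xs \<le> x + y + z"
    by auto
  have "s \<in> S" "s \<noteq> 0" using Cons.prems by auto
  then obtain x' y' z' where 2: "s = x' * m + y' * a + z' * b"
    using mem_S_iff by blast
  with \<open>s \<noteq> 0\<close> have "1 \<le> x' + y' + z'" by (cases "x' + y' + z'") auto
  with 1 2 have "sum_list (s # xs) = (x + x') * m + (y + y') * a + (z + z') * b \<and>
      length (s # xs) \<le> (x + x') + (y + y') + (z + z')"
    by (simp add: algebra_simps)
  then show ?case by blast
qed

lemma multiple_M_exact: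
  "x * m + y * a + z * b \<in> multiple_M S (x + y + z)"
proof (cases "x + y + z = 0")
  case True
  then show ?thesis by (simp add: multiple_M_def zero_mem)
next
  case False
  let ?xs = "replicate x m @ replicate y a @ replicate z b"
  have "{m, a, b} \<subseteq> S - {0}"
    using mem_S[of 1 0 0] mem_S[of 0 1 0] mem_S[of 0 0 1] m_pos m_less_a a_less_b by simp
  moreover have "set ?xs \<subseteq> {m, a, b}" by (auto simp: in_set_replicate)
  ultimately have "set ?xs \<subseteq> S - {0}" by blast
  moreover have "length ?xs = x + y + z" "sum_list ?xs = x * m + y * a + z * b"
    by (simp_all add: sum_list_replicate)
  ultimately have "\<exists>xs. x * m + y * a + z * b = sum_list xs \<and> length xs = x + y + z \<and>
      set xs \<subseteq> S - {0}"
    by metis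
  then show ?thesis using False unfolding multiple_M_def by auto
qed

text \<open>Merging the first two summands shortens a sum by one; \<open>h = 0\<close> is separate
  because of the convention 0M = S.\<close>

lemma multiple_M_Suc: "multiple_M S (Suc h) \<subseteq> multiple_M S h"
proof
  fix s assume "s \<in> multiple_M S (Suc h)"
  then obtain xs where xs: "s = sum_list xs" "length xs = Suc h" "set xs \<subseteq> S - {0}"
    by (auto simp: multiple_M_def)
  show "s \<in> multiple_M S h"
  proof (cases h)
    case 0
    then show ?thesis
      using xs sum_list_representation[OF xs(3)] mem_S_iff by (auto simp: multiple_M_def)
  next
    case (Suc k)
    then obtain u v ys where ys: "xs = u # v # ys"
      using xs(2) by (metis length_Suc_conv)
    have "set ((u + v) # ys) \<subseteq> S - {0}" using xs(3) ys add_mem by auto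
    moreover have "sum_list ((u + v) # ys) = s" "length ((u + v) # ys) = h"
      using xs ys by simp_all
    ultimately have "\<exists>xs. s = sum_list xs \<and> length xs = h \<and> set xs \<subseteq> S - {0}"
      by metis
    then show ?thesis using Suc by (simp add: multiple_M_def)
  qed
qed

lemma multiple_M_antimono: "h \<le> k \<Longrightarrow> multiple_M S k \<subseteq> multiple_M S h"
  using lift_Suc_antimono_le[of "multiple_M S"] multiple_M_Suc by blast

lemma mem_multiple_M_iff:
  "s \<in> multiple_M S h \<longleftrightarrow> (\<exists>x y z. s = x * m + y * a + z * b \<and> h \<le> x + y + z)"
proof
  assume s: "s \<in> multiple_M S h"
  show "\<exists>x y z. s = x * m + y * a + z * b \<and> h \<le> x + y + z"
  proof (cases "h = 0")
    case True
    then show ?thesis using s mem_S_iff by (simp add: multiple_M_def)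
  next
    case False
    then show ?thesis using s sum_list_representation by (auto simp: multiple_M_def)
  qed
next
  assume "\<exists>x y z. s = x * m + y * a + z * b \<and> h \<le> x + y + z"
  then show "s \<in> multiple_M S h"
    using multiple_M_exact multiple_M_antimono by blast
qed

text \<open>Membership in hM asks for a representation of length at least \<open>h\<close>, so the
  length of a longest one is the unique point where membership stops, as the \<open>THE\<close> in
  \<open>ord\<close> requires.\<close>

lemma ord_eqI:
  assumes "s = x * m + y * a + z * b"
    and "\<And>x' y' z'. s = x' * m + y' * a + z' * b \<Longrightarrow> x' + y' + z' \<le> x + y + z"
  shows "ord S s = x + y + z"
  unfolding ord_def
proof (rule the_equality)
  show "s \<in> multiple_M S (x + y + z) - multiple_M S (x + y + z + 1)"
    using assms unfolding Diff_iff mem_multiple_M_iff by fastforce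
next
  fix h assume h: "s \<in> multiple_M S h - multiple_M S (h + 1)"
  then have "h \<le> x + y + z"
    using assms(2) mem_multiple_M_iff by (metis Diff_iff order_trans)
  moreover have "\<not> h + 1 \<le> x + y + z"
    using h assms(1) unfolding Diff_iff mem_multiple_M_iff by blast
  ultimately show "h = x + y + z" by simp
qed

lemma ord_representation:
  assumes "s \<in> S"
  obtains x y z where "s = x * m + y * a + z * b" "ord S s = x + y + z"
    "\<And>x' y' z'. s = x' * m + y' * a + z' * b \<Longrightarrow> x' + y' + z' \<le> ord S s"
proof -
  let ?P = "\<lambda>n. \<exists>x y z. s = x * m + y * a + z * b \<and> n = x + y + z"
  obtain n where "?P n" using assms mem_S_iff by blast
  \<comment> \<open>The generators are positive, so lengths are bounded by \<open>s\<close> and a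
    longest representation exists.\<close>
  moreover have bound: "\<And>n. ?P n \<Longrightarrow> n \<le> s" using length_le by blast
  ultimately obtain k where k: "?P k" "\<And>n. ?P n \<Longrightarrow> n \<le> k"
    using Nat.ex_has_greatest_nat[of ?P n s] by blast
  then obtain x y z where xyz: "s = x * m + y * a + z * b" "k = x + y + z" by blast
  have longest: "x' + y' + z' \<le> x + y + z" if "s = x' * m + y' * a + z' * b" for x' y' z'
    using k(2) xyz(2) that by blast
  have "ord S s = x + y + z"
    using xyz(1) longest by (rule ord_eqI)
  with xyz(1) longest that show ?thesis by metis
qed

lemma ord_ge:
  assumes "s = x * m + y * a + z * b"
  shows "x + y + z \<le> ord S s"
  using ord_representation[of s] assms mem_S by metis

section \<open>The Apery set and its closure under summands\<close>

lemma mem_apery_iff: "w \<in> apery S \<longleftrightarrow> w \<in> S \<and> (\<forall>s\<in>S. w \<noteq> s + m)"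
proof -
  have "int w - int m \<in> int ` S \<longleftrightarrow> (\<exists>s\<in>S. w = s + m)"
    by (force simp: image_iff)
  then show ?thesis
    by (auto simp: apery_def multiplicity_eq)
qed

lemma apery_subset: "w \<in> apery S \<Longrightarrow> w \<in> S"
  by (simp add: apery_def)

lemma zero_mem_apery: "0 \<in> apery S"
  using zero_mem m_pos by (simp add: mem_apery_iff)

lemma apery_summand:
  assumes "s + t \<in> apery S" "s \<in> S" "t \<in> S"
  shows "s \<in> apery S"
proof -
  have "s \<noteq> u + m" if "u \<in> S" for u
  proof
    assume "s = u + m"
    then have "s + t = (u + t) + m" by simp
    then show False using assms that add_mem by (metis mem_apery_iff)
  qed
  then show ?thesis using assms(2) by (simp add: mem_apery_iff)
qed

lemma apery_summand':
  assumes "s + t \<in> apery S" "s \<in> S" "t \<in> S"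
  shows "t \<in> apery S"
  using apery_summand[of t s] assms by (simp add: add.commute)

lemma finite_apery: "finite (apery S)"
proof -
  \<comment> \<open>An Apery element not below \<open>m\<close> is a gap shifted up by
    \<open>m\<close>, and there are finitely many gaps.\<close>
  have "apery S \<subseteq> {..<m} \<union> (\<lambda>x. x + m) ` (UNIV - S)"
  proof
    fix w assume w: "w \<in> apery S"
    show "w \<in> {..<m} \<union> (\<lambda>x. x + m) ` (UNIV - S)"
    proof (cases "w < m")
      case False
      then have "w = (w - m) + m" by simp
      moreover from this w have "w - m \<notin> S" unfolding mem_apery_iff by blast
      ultimately show ?thesis by blast
    qed simp
  qed
  then show ?thesis using finite_gaps finite_subset by blast
qed

section \<open>Apery elements as combinations of \<open>a\<close> and \<open>b\<close>\<close>

lemma no_multiplicity: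
  assumes "x * m + y * a + z * b \<in> apery S"
  shows "x = 0"
proof (cases x)
  case (Suc k)
  then have "x * m + y * a + z * b = (k * m + y * a + z * b) + m" by simp
  then show ?thesis using assms mem_S by (metis mem_apery_iff)
qed

lemma apery_ord_representation:
  assumes "w \<in> apery S"
  obtains y z where "w = y * a + z * b" "ord S w = y + z"
proof -
  obtain x y z where "w = x * m + y * a + z * b" "ord S w = x + y + z"
    using ord_representation[OF apery_subset[OF assms]] by metis
  with no_multiplicity assms that show ?thesis by fastforce
qed

lemma ord_ge_ab: "y + z \<le> ord S (y * a + z * b)"
  using ord_ge[of "y * a + z * b" 0 y z] by simp

lemma split_coefficients:
  assumes "y' \<le> y" "z' \<le> z"
  shows "y * a + z * b = (y' * a + z' * b) + ((y - y') * a + (z - z') * b)"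
proof -
  obtain k l where "y = y' + k" "z = z' + l"
    using assms le_Suc_ex by meson
  then show ?thesis by (simp add: algebra_simps)
qed

lemma apery_ab_mono:
  assumes "y * a + z * b \<in> apery S" "y' \<le> y" "z' \<le> z"
  shows "y' * a + z' * b \<in> apery S"
  using apery_summand ab_mem assms split_coefficients by metis

text \<open>A longer representation of the smaller combination could be substituted into the larger
  one and would exceed its order.\<close>

lemma ord_ab_mono:
  assumes "y * a + z * b \<in> apery S" "ord S (y * a + z * b) = y + z" "y' \<le> y" "z' \<le> z"
  shows "ord S (y' * a + z' * b) = y' + z'"
proof -
  obtain k l where kl: "y' * a + z' * b = k * a + l * b" "ord S (y' * a + z' * b) = k + l"
    using apery_ord_representation apery_ab_mono[OF assms(1,3,4)] by metis
  have "y * a + z * b = (y' * a + z' * b) + ((y - y') * a + (z - z') * b)"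
    using assms(3,4) by (rule split_coefficients)
  also have "\<dots> = (k + (y - y')) * a + (l + (z - z')) * b"
    unfolding kl(1) by (simp add: algebra_simps)
  finally have "(k + (y - y')) + (l + (z - z')) \<le> y + z"
    using ord_ge_ab assms(2) by metis
  then show ?thesis using kl(2) ord_ge_ab[of y' z'] assms(3,4) by linarith
qed

text \<open>In the Apery set only \<open>a\<close> and \<open>b\<close> occur, and \<open>a\<close>
  is the smaller, so no representation has more summands than copies of \<open>a\<close>
  alone.\<close>

lemma ord_multiple_a:
  assumes "y * a \<in> apery S"
  shows "ord S (y * a) = y"
proof -
  obtain k l where kl: "y * a = k * a + l * b" "ord S (y * a) = k + l"
    using apery_ord_representation assms by metis
  have "l * a \<le> l * b" using a_less_b by simp
  then have "(k + l) * a \<le> y * a" using kl by (simp add: add_mult_distrib)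
  then have "k + l \<le> y" using m_less_a by simp
  then show ?thesis using kl ord_ge_ab[of y 0] by simp
qed

text \<open>At equal value, extra copies of the smaller \<open>a\<close> must replace strictly fewer
  copies of \<open>b\<close>.\<close>

lemma trade_longer:
  assumes "y * a + z * b = y' * a + z' * b" "y < y'"
  shows "y + z < y' + z'"
proof (rule ccontr)
  assume not_less: "\<not> y + z < y' + z'"
  define k l where "k = y' - y" and "l = z - z'"
  have k: "y' = y + k" "0 < k" and l: "z = z' + l" "k \<le> l"
    using assms(2) not_less by (auto simp: k_def l_def)
  have "l * b = k * a" using assms(1) k l by (simp add: algebra_simps)
  moreover have "k * a < k * b" using k a_less_b by simp
  moreover have "k * b \<le> l * b" using l by simp
  ultimately show False by linarith
qed

text \<open>More copies of \<open>a\<close> would make the representation longer than the order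
  allows.\<close>

lemma maximal_coefficient_a:
  assumes "y * a + z * b = y' * a + z' * b" "ord S (y * a + z * b) = y + z"
  shows "y' \<le> y"
  using trade_longer[OF assms(1)] ord_ge_ab[of y' z'] assms
  by (metis leD linorder_le_less_linear)

lemma maximal_representation_unique:
  assumes "y * a + z * b = y' * a + z' * b"
    and "ord S (y * a + z * b) = y + z" "ord S (y' * a + z' * b) = y' + z'"
  shows "y = y' \<and> z = z'"
proof -
  have "y = y'"
    using maximal_coefficient_a assms by (metis order_antisym)
  then show ?thesis using assms(1) a_less_b by simp
qed

section \<open>The bounds beta and gamma\<close>

lemma finite_beta:
  assumes "0 < g"
  shows "finite {h. h * g \<in> apery S \<and> ord S (h * g) = h}"
proof (rule finite_subset)
  \<comment> \<open>Every such \<open>h\<close> is itself the order of the Apery element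
    \<open>h * g\<close>.\<close>
  show "{h. h * g \<in> apery S \<and> ord S (h * g) = h} \<subseteq> ord S ` apery S"
    by force
qed (simp add: finite_apery)

lemma ord_zero: "ord S 0 = 0"
  using ord_multiple_a[of 0] zero_mem_apery by simp

lemma
  assumes "0 < g"
  shows beta_mem: "beta S g * g \<in> apery S"
    and ord_beta: "ord S (beta S g * g) = beta S g"
proof -
  \<comment> \<open>The zero multiple makes the set nonempty, so its \<open>Max\<close> is
    attained.\<close>
  have "0 \<in> {h. h * g \<in> apery S \<and> ord S (h * g) = h}"
    using zero_mem_apery ord_zero by simp
  then show "beta S g * g \<in> apery S" "ord S (beta S g * g) = beta S g"
    using Max_in[OF finite_beta[OF assms]] unfolding beta_def by blast+
qed

lemma le_beta:
  assumes "0 < g" "h * g \<in> apery S" "ord S (h * g) = h"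
  shows "h \<le> beta S g"
  unfolding beta_def using assms by (intro Max_ge finite_beta) auto

lemma a_pos: "0 < a" and b_pos: "0 < b"
  using m_less_a a_less_b by simp_all

text \<open>Multiples of \<open>a\<close> in the Apery set automatically have the right order, so
  the bound holds for every representation, maximal or not; the bound at \<open>b\<close> assumes a
  maximal one.\<close>

lemma le_beta_a:
  assumes "y * a + z * b \<in> apery S"
  shows "y \<le> beta S a"
  using le_beta[OF a_pos] ord_multiple_a apery_ab_mono[OF assms, of y 0] by simp

lemma le_beta_b:
  assumes "y * a + z * b \<in> apery S" "ord S (y * a + z * b) = y + z"
  shows "z \<le> beta S b"
  using le_beta[OF b_pos] ord_ab_mono[OF assms, of 0 z] apery_ab_mono[OF assms(1), of 0 z]
  by simp

lemma apery_maximal_representation_ex1: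
  assumes w: "w \<in> apery S"
  shows "\<exists>!c. c \<in> maximal_representations S {m, a, b} w"
proof -
  have distinct: "m \<noteq> a" "m \<noteq> b" "a \<noteq> b" using m_less_a a_less_b by auto
  have iff: "c \<in> maximal_representations S {m, a, b} w \<longleftrightarrow>
      (\<forall>x. x \<notin> {m, a, b} \<longrightarrow> c x = 0) \<and> w = c m * m + c a * a + c b * b \<and>
      c m + c a + c b = ord S w" for c
    using distinct by (simp add: maximal_representations_def representations_def add.assoc)
  obtain y z where yz: "w = y * a + z * b" "ord S w = y + z"
    using apery_ord_representation w by metis
  show ?thesis
  proof
    show "(\<lambda>x. 0)(a := y, b := z) \<in> maximal_representations S {m, a, b} w"
      using distinct yz unfolding iff by simp
  next
    fix c assume c: "c \<in> maximal_representations S {m, a, b} w"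
    then have c_rep: "w = c m * m + c a * a + c b * b" "c m + c a + c b = ord S w"
      unfolding iff by blast+
    then have "c m = 0" using no_multiplicity w by metis
    with c_rep yz have "c a = y \<and> c b = z"
      using maximal_representation_unique[of "c a" "c b" y z] by simp
    moreover have "c x = 0" if "x \<noteq> a" "x \<noteq> b" for x
      using c \<open>c m = 0\<close> that unfolding iff by (cases "x = m") auto
    ultimately show "c = (\<lambda>x. 0)(a := y, b := z)"
      by (simp add: fun_eq_iff)
  qed
qed

lemma gamma_eq_beta: "gamma S {m, a, b} = beta S"
proof
  fix g
  have "{h. h * g \<in> apery S \<and> ord S (h * g) = h \<and>
          (\<exists>!c. c \<in> maximal_representations S {m, a, b} (h * g))} =
        {h. h * g \<in> apery S \<and> ord S (h * g) = h}"
    using apery_maximal_representation_ex1 by blast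
  then show "gamma S {m, a, b} g = beta S g"
    unfolding gamma_def beta_def by simp
qed

section \<open>Boxes and rectangularity\<close>

lemma mem_box_iff:
  "w \<in> box ({m, a, b} - {multiplicity S}) f \<longleftrightarrow> (\<exists>y z. w = y * a + z * b \<and> y \<le> f a \<and> z \<le> f b)"
proof -
  have ab: "{m, a, b} - {multiplicity S} = {a, b}" "a \<noteq> b"
    using m_less_a a_less_b by (auto simp: multiplicity_eq)
  show ?thesis
  proof
    assume "w \<in> box ({m, a, b} - {multiplicity S}) f"
    then show "\<exists>y z. w = y * a + z * b \<and> y \<le> f a \<and> z \<le> f b"
      unfolding ab(1) box_def using ab(2) by auto
  next
    assume "\<exists>y z. w = y * a + z * b \<and> y \<le> f a \<and> z \<le> f b"
    then obtain y z where yz: "w = y * a + z * b" "y \<le> f a" "z \<le> f b" by blast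
    let ?c = "(\<lambda>x. 0)(a := y, b := z)"
    have "w = (\<Sum>g\<in>{a, b}. ?c g * g)" "\<forall>g\<in>{a, b}. ?c g \<le> f g"
      using yz ab(2) by simp_all
    then show "w \<in> box ({m, a, b} - {multiplicity S}) f"
      unfolding ab(1) box_def by blast
  qed
qed

text \<open>Maximal representations place the Apery set inside the box, and the Apery set is closed
  under lowering coefficients, so only the corner has to be tested.\<close>

lemma beta_rectangular_iff:
  "beta_rectangular S {m, a, b} \<longleftrightarrow> beta S a * a + beta S b * b \<in> apery S"
proof
  assume "beta_rectangular S {m, a, b}"
  then show "beta S a * a + beta S b * b \<in> apery S"
    unfolding beta_rectangular_def using mem_box_iff by blast
next
  assume corner: "beta S a * a + beta S b * b \<in> apery S"
  show "beta_rectangular S {m, a, b}"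
    unfolding beta_rectangular_def
  proof (intro set_eqI iffI)
    fix w assume "w \<in> apery S"
    then show "w \<in> box ({m, a, b} - {multiplicity S}) (beta S)"
      unfolding mem_box_iff using apery_ord_representation le_beta_a le_beta_b by metis
  next
    fix w assume "w \<in> box ({m, a, b} - {multiplicity S}) (beta S)"
    then show "w \<in> apery S"
      unfolding mem_box_iff using apery_ab_mono[OF corner] by blast
  qed
qed

section \<open>Residue classes modulo \<open>m\<close>, Frobenius number and symmetry\<close>

lemma residue_mem:
  obtains s where "s \<in> S" "int m dvd x - int s"
proof -
  \<comment> \<open>The progression of step \<open>m\<close> starting at the remainder of
    \<open>x\<close> is infinite, so it cannot consist of gaps only.\<close>
  have "inj (\<lambda>k. nat (x mod int m) + k * m)"
    using m_pos by (simp add: inj_on_def)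
  then have "infinite (range (\<lambda>k. nat (x mod int m) + k * m))"
    using finite_imageD infinite_UNIV_nat by blast
  then have "\<not> range (\<lambda>k. nat (x mod int m) + k * m) \<subseteq> UNIV - S"
    using finite_gaps finite_subset by blast
  then obtain k where k: "nat (x mod int m) + k * m \<in> S" by blast
  have "x - int (nat (x mod int m) + k * m) = (x - x mod int m) - int k * int m"
    using m_pos by simp
  moreover have "int m dvd x - x mod int m" by (simp add: minus_mod_eq_mult_div)
  ultimately have "int m dvd x - int (nat (x mod int m) + k * m)"
    by (metis dvd_diff dvd_triv_right)
  with k that show ?thesis by blast
qed

lemma congruent_ge_mem:
  assumes "s \<in> S" "int m dvd x - int s" "int s \<le> x"
  shows "x \<in> int ` S"
proof -
  obtain q where q: "x - int s = int m * q" using assms(2) by blast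
  then have "0 \<le> q" using assms(3) m_pos
    by (metis diff_ge_0_iff_ge of_nat_0_less_iff zero_le_mult_iff not_le order_less_imp_le)
  then have "x = int (s + nat q * m)" using q by (simp add: algebra_simps)
  then show ?thesis using add_multiple_mem[OF assms(1)] by blast
qed

text \<open>The least element of \<open>S\<close> in the class of \<open>x\<close> is an Apery
  element, since subtracting \<open>m\<close> stays in the class. It decides membership for the
  whole class, negative integers included.\<close>

lemma apery_residue:
  obtains w where "w \<in> apery S" "int m dvd x - int w" "x \<in> int ` S \<longleftrightarrow> int w \<le> x"
proof -
  let ?P = "\<lambda>s. s \<in> S \<and> int m dvd x - int s"
  define w where "w = (LEAST s. ?P s)"
  have ex: "\<exists>s. ?P s" using residue_mem[of x] by metis
  have w: "?P w" unfolding w_def by (rule LeastI_ex[OF ex])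
  have least: "w \<le> s" if "?P s" for s unfolding w_def using that by (rule Least_le)
  have "w \<noteq> s + m" if "s \<in> S" for s
  proof
    assume eq: "w = s + m"
    have "x - int s = (x - int w) + int m" using eq by simp
    then have "?P s" using w that by (metis dvd_add dvd_refl)
    then show False using least eq m_pos by fastforce
  qed
  then have "w \<in> apery S" using w by (simp add: mem_apery_iff)
  moreover have "x \<in> int ` S \<longleftrightarrow> int w \<le> x"
    using w least congruent_ge_mem by auto
  ultimately show ?thesis using that w by blast
qed

text \<open>This number is the Frobenius number plus the multiplicity.\<close>

definition top_apery :: nat where
  "top_apery = Max (apery S)"

lemma top_mem: "top_apery \<in> apery S"
  unfolding top_apery_def using finite_apery zero_mem_apery by (intro Max_in) auto

lemma le_top: "w \<in> apery S \<Longrightarrow> w \<le> top_apery"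
  unfolding top_apery_def using finite_apery by simp

lemma frobenius_eq: "frobenius S = int top_apery - int m"
  unfolding frobenius_def
proof (rule Greatest_equality)
  show "int top_apery - int m \<notin> int ` S"
    using top_mem by (simp add: apery_def multiplicity_eq)
next
  fix x assume x: "x \<notin> int ` S"
  obtain w where w: "w \<in> apery S" "int m dvd x - int w" "x \<in> int ` S \<longleftrightarrow> int w \<le> x"
    using apery_residue by blast
  \<comment> \<open>An integer outside \<open>S\<close> lies below the Apery element of its class,
    hence at least \<open>m\<close> below it.\<close>
  then have "0 < int w - x" "int m dvd int w - x"
    using x by (auto simp: dvd_diff_commute)
  then have "int m \<le> int w - x" by (rule zdvd_imp_le[rotated])
  then show "x \<le> int top_apery - int m" using le_top[OF w(1)] by linarith
qed

text \<open>The reflection of \<open>x\<close> to \<open>f - x\<close>, with \<open>f\<close> the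
  Frobenius number, becomes a pairing of Apery elements with sum \<open>top_apery\<close>.\<close>

lemma symmetric_iff: "symmetric S \<longleftrightarrow> (\<forall>w\<in>apery S. \<exists>u\<in>apery S. w + u = top_apery)"
proof
  assume sym: "symmetric S"
  show "\<forall>w\<in>apery S. \<exists>u\<in>apery S. w + u = top_apery"
  proof
    fix w assume w: "w \<in> apery S"
    \<comment> \<open>The left side equals \<open>w - m\<close>, which is outside \<open>S\<close>
      because \<open>w\<close> is an Apery element.\<close>
    have "frobenius S - (int top_apery - int w) \<notin> int ` S"
      using w by (simp add: frobenius_eq apery_def multiplicity_eq)
    then have "int top_apery - int w \<in> int ` S"
      using sym unfolding symmetric_def by blast
    then obtain u where u: "u \<in> S" "int top_apery - int w = int u" by blast
    then have "w + u = top_apery" by linarith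
    moreover from this u have "u \<in> apery S"
      using apery_summand' top_mem apery_subset[OF w] by metis
    ultimately show "\<exists>u\<in>apery S. w + u = top_apery" by blast
  qed
next
  assume compl: "\<forall>w\<in>apery S. \<exists>u\<in>apery S. w + u = top_apery"
  show "symmetric S"
    unfolding symmetric_def
  proof (intro allI impI, rule ccontr)
    fix x :: int
    assume f: "frobenius S - x \<notin> int ` S" and x: "x \<notin> int ` S"
    obtain w where w: "w \<in> apery S" "int m dvd x - int w" "x \<in> int ` S \<longleftrightarrow> int w \<le> x"
      using apery_residue by blast
    obtain u where u: "u \<in> apery S" "w + u = top_apery" using compl w by blast
    have "0 < int w - x" "int m dvd int w - x"
      using x w by (auto simp: dvd_diff_commute)
    then have "int m \<le> int w - x" by (rule zdvd_imp_le[rotated])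
    \<comment> \<open>The partner \<open>u\<close> of \<open>w\<close> is congruent to
      \<open>frobenius S - x\<close> and does not exceed it, which puts
      \<open>frobenius S - x\<close> in \<open>S\<close>.\<close>
    moreover have eq: "frobenius S - x - int u = (int w - x) - int m"
      using u by (simp add: frobenius_eq)
    ultimately have "int u \<le> frobenius S - x" by linarith
    moreover have "int m dvd frobenius S - x - int u"
      unfolding eq using \<open>int m dvd int w - x\<close> by simp
    ultimately show False
      using f congruent_ge_mem apery_subset[OF u(1)] by blast
  qed
qed

section \<open>Rectangularity against M-purity with symmetry\<close>

lemma top_maximal: "top_apery \<in> maximal_apery S"
proof -
  have "v = top_apery" if "v \<in> apery S" "le_M S top_apery v" for v
    using that le_top unfolding le_M_def by fastforce
  then show ?thesis unfolding maximal_apery_def using top_mem by blast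
qed

lemma rectangular_imp_pure_symmetric:
  assumes corner: "beta S a * a + beta S b * b \<in> apery S"
  shows "M_pure S \<and> symmetric S"
proof -
  let ?A = "beta S a" and ?B = "beta S b"
  let ?w = "?A * a + ?B * b"
  \<comment> \<open>A maximal representation of the corner is itself bounded coordinatewise by the
    box, so it cannot be longer than the corner's own coefficients.\<close>
  have ord_corner: "ord S ?w = ?A + ?B"
  proof -
    obtain y z where yz: "?w = y * a + z * b" "ord S ?w = y + z"
      using apery_ord_representation corner by metis
    have "y \<le> ?A" using le_beta_a[of y z] corner yz by simp
    moreover have "z \<le> ?B" using le_beta_b[of y z] corner yz by simp
    ultimately show ?thesis using yz(2) ord_ge_ab[of ?A ?B] by linarith
  qed
  have below: "\<exists>u\<in>apery S. w + u = ?w \<and> ord S w + ord S u = ord S ?w" if w: "w \<in> apery S" for w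
  proof -
    obtain y z where yz: "w = y * a + z * b" "ord S w = y + z"
      using apery_ord_representation w by metis
    have le: "y \<le> ?A" "z \<le> ?B" using yz w le_beta_a le_beta_b by auto
    \<comment> \<open>The complementary point of the box; coefficients of maximal representations
      add up, hence so do the orders.\<close>
    let ?u = "(?A - y) * a + (?B - z) * b"
    have "?u \<in> apery S" using apery_ab_mono[OF corner] by simp
    moreover have "ord S ?u = (?A - y) + (?B - z)"
      using ord_ab_mono[OF corner ord_corner] by simp
    moreover have "w + ?u = ?w"
      using split_coefficients[OF le] yz by simp
    ultimately show ?thesis using yz(2) ord_corner le by (intro bexI[of _ ?u]) auto
  qed
  have "?w = top_apery"
    using below[OF top_mem] le_top[OF corner] by fastforce
  then have "symmetric S"
    using below symmetric_iff by metis
  moreover have "w = ?w" if "w \<in> maximal_apery S" for w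
  proof -
    have w: "w \<in> apery S" using that by (simp add: maximal_apery_def)
    have "le_M S w ?w"
      using below[OF w] w corner apery_subset unfolding le_M_def by blast
    then show ?thesis using that corner unfolding maximal_apery_def by blast
  qed
  then have "M_pure S"
    unfolding M_pure_def by metis
  ultimately show ?thesis by blast
qed

text \<open>With coefficient \<open>beta S b\<close> at \<open>b\<close>, take the greatest
  \<open>y\<close> that keeps the representation maximal. Going up for \<open>le_M\<close> adds
  coefficients: the one at \<open>b\<close> is capped by \<open>beta S b\<close>, the one at
  \<open>a\<close> by the choice of \<open>y\<close>.\<close>

lemma maximal_above_beta_b:
  obtains y where "y * a + beta S b * b \<in> maximal_apery S"
    "ord S (y * a + beta S b * b) = y + beta S b"
proof -
  let ?B = "beta S b"
  let ?P = "\<lambda>y. y * a + ?B * b \<in> apery S \<and> ord S (y * a + ?B * b) = y + ?B"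
  have "?P 0" using beta_mem[OF b_pos] ord_beta[OF b_pos] by simp
  moreover have "\<And>y. ?P y \<Longrightarrow> y \<le> beta S a" using le_beta_a by blast
  ultimately obtain y where y: "?P y" and greatest: "\<And>y'. ?P y' \<Longrightarrow> y' \<le> y"
    using Nat.ex_has_greatest_nat[of ?P 0 "beta S a"] by blast
  have "v = y * a + ?B * b" if v: "v \<in> apery S" "le_M S (y * a + ?B * b) v" for v
  proof -
    obtain u where u: "u \<in> S" "y * a + ?B * b + u = v" "y + ?B + ord S u = ord S v"
      using v(2) y unfolding le_M_def by auto
    then have "u \<in> apery S" using apery_summand' ab_mem v(1) by metis
    then obtain k l where kl: "u = k * a + l * b" "ord S u = k + l"
      using apery_ord_representation by metis
    have v_eq: "v = (y + k) * a + (?B + l) * b"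
      using u(2) kl(1) by (simp add: algebra_simps)
    have ord_v: "ord S v = (y + k) + (?B + l)" using u(3) kl(2) by simp
    have "?B + l \<le> ?B" using le_beta_b v(1) ord_v unfolding v_eq by blast
    then have "l = 0" by simp
    then have "?P (y + k)" using v(1) ord_v v_eq by simp
    then have "k = 0" using greatest by fastforce
    then show ?thesis using v_eq \<open>l = 0\<close> by simp
  qed
  then show ?thesis using that y unfolding maximal_apery_def by blast
qed

lemma pure_symmetric_imp_rectangular:
  assumes "M_pure S" "symmetric S"
  shows "beta S a * a + beta S b * b \<in> apery S"
proof -
  let ?A = "beta S a" and ?B = "beta S b"
  obtain p q where pq: "top_apery = p * a + q * b" "ord S top_apery = p + q"
    using apery_ord_representation top_mem by metis
  have "p \<le> ?A" using pq top_mem le_beta_a by simp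
  have "q \<le> ?B" using pq top_mem le_beta_b by simp
  obtain y where y: "y * a + ?B * b \<in> maximal_apery S" "ord S (y * a + ?B * b) = y + ?B"
    using maximal_above_beta_b by blast
  have length_eq: "y + ?B = p + q"
    using assms(1) y top_maximal pq(2) unfolding M_pure_def by metis
  have "q = ?B"
  proof (rule ccontr)
    assume "q \<noteq> ?B"
    \<comment> \<open>At equal length the two representations differ by \<open>d\<close> copies of
      \<open>a\<close> exchanged for \<open>b\<close>. As \<open>a < b\<close>, the element with
      more copies of \<open>b\<close> would exceed the largest Apery element.\<close>
    define d where "d = ?B - q"
    have d: "?B = q + d" "p = y + d" "0 < d"
      using \<open>q \<le> ?B\<close> \<open>q \<noteq> ?B\<close> length_eq by (auto simp: d_def)
    have "y * a + ?B * b \<le> top_apery"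
      using y(1) le_top by (simp add: maximal_apery_def)
    then have "d * b \<le> d * a" unfolding pq(1) d by (simp add: algebra_simps)
    then show False using d(3) a_less_b by simp
  qed
  \<comment> \<open>The partner of \<open>?A * a\<close> yields a representation of
    \<open>top_apery\<close> with at least \<open>?A\<close> copies of \<open>a\<close>, while
    \<open>p\<close> is the largest coefficient possible there.\<close>
  obtain u where u: "u \<in> apery S" "?A * a + u = top_apery"
    using assms(2) symmetric_iff beta_mem[OF a_pos] by blast
  obtain k l where kl: "u = k * a + l * b"
    using apery_ord_representation u(1) by metis
  have "p * a + q * b = (?A + k) * a + l * b"
    using u(2) kl pq(1) by (simp add: algebra_simps)
  then have "?A + k \<le> p"
    using maximal_coefficient_a pq by metis
  with \<open>p \<le> ?A\<close> have "p = ?A" by simp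
  with \<open>q = ?B\<close> pq(1) top_mem show ?thesis by simp
qed

end

section \<open>From minimal generation to coefficient triples\<close>

lemma generated_remove_zero: "generated G = generated (G - {0})" if "finite G"
proof -
  have "(\<Sum>g\<in>G. c g * g) = (\<Sum>g\<in>G - {0}. c g * g)" for c
    using that by (intro sum.mono_neutral_right) auto
  then show ?thesis by (simp add: generated_def)
qed

lemma mem_generated_three:
  assumes "m < a" "a < b"
  shows "s \<in> generated {m, a, b} \<longleftrightarrow> (\<exists>x y z. s = x * m + y * a + z * b)"
proof
  assume "s \<in> generated {m, a, b}"
  then obtain c where "s = (\<Sum>g\<in>{m, a, b}. c g * g)" by (auto simp: generated_def)
  then have "s = c m * m + c a * a + c b * b" using assms by (simp add: add.assoc)
  then show "\<exists>x y z. s = x * m + y * a + z * b" by blast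
next
  assume "\<exists>x y z. s = x * m + y * a + z * b"
  then obtain x y z where xyz: "s = x * m + y * a + z * b" by blast
  let ?c = "(\<lambda>g. 0)(m := x, a := y, b := z)"
  have "s = (\<Sum>g\<in>{m, a, b}. ?c g * g)" using xyz assms by simp
  then show "s \<in> generated {m, a, b}" unfolding generated_def by blast
qed

theorem theorem3p14:
  fixes S :: "nat set" and g1 g2 g3 :: nat
  assumes "numerical_semigroup S"
    and "minimally_generated S {g1, g2, g3}"
    and "g1 < g2" and "g2 < g3"
  shows "(beta_rectangular S {g1, g2, g3} \<longleftrightarrow> gamma_rectangular S {g1, g2, g3}) \<and>
         (gamma_rectangular S {g1, g2, g3} \<longleftrightarrow> M_pure S \<and> symmetric S)"
proof -
  have "g1 \<noteq> 0"
  proof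
    assume "g1 = 0"
    \<comment> \<open>A zero generator could be dropped without changing the generated set, against
      minimality.\<close>
    then have "{g1, g2, g3} - {0} \<subset> {g1, g2, g3}" by blast
    then show False
      using assms(2) generated_remove_zero[of "{g1, g2, g3}"]
      unfolding minimally_generated_def by blast
  qed
  then interpret three_generated S g1 g2 g3
    using assms mem_generated_three[OF assms(3,4)]
    by unfold_locales (simp_all add: minimally_generated_def numerical_semigroup_def)
  have "gamma_rectangular S {g1, g2, g3} \<longleftrightarrow> beta_rectangular S {g1, g2, g3}"
    unfolding gamma_rectangular_def beta_rectangular_def gamma_eq_beta ..
  then show ?thesis
    using beta_rectangular_iff rectangular_imp_pure_symmetric pure_symmetric_imp_rectangular
    by blast
qed

end
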